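(* Let $s\ge 2$ be an integer and $A_s=\{e_0,\dots,e_{s-1}\}$ with $0<e_0<e_1<\dots<e_{s-1}$. There exist constants $C_1,C_2$ (depending only on $A_s$) such that for every $m\ge 1$, every $(c_1,\dots,c_m)\in A_s^m$ and every $c\in A_s$, $$0<C_1<\frac{|\bar\Delta^{A_s}_{c_1\ldots c_m c}|}{|\bar\Delta^{A_s}_{c_1\ldots c_m}|}<C_2<1 .$$
   Context: For a sequence $(a_n)_{n\ge1}$ with $a_n\in A_s$, $[0;a_1,a_2,\dots]$ denotes the value of the infinite continued fraction $\cfrac{1}{a_1+\cfrac{1}{a_2+\cdots}}$ (the limit of its convergents, which exists for all such sequences). For $c_1,\dots,c_m\in A_s$, the cylinder of rank $m$ with base $c_1\ldots c_m$ is $\Delta^{A_s}_{c_1\ldots c_m}=\{[0;c_1,\dots,c_m,\alpha_1,\alpha_2,\dots]: \alpha_n\in A_s \text{ for all } n\}$. The cylindrical interval $\bar\Delta^{A_s}_{c_1\ldots c_m}$ is the smallest closed interval containing $\Delta^{A_s}_{c_1\ldots c_m}$, and $|\bar\Delta^{A_s}_{c_1\ldots c_m}|$ is its length (equal to the diameter of the cylinder). *)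

theory Defs
  imports "HOL-Analysis.Analysis" "HOL-Library.Stream"
begin

definition finite_cfrac :: "real list \<Rightarrow> real" where
  "finite_cfrac cs = foldr (\<lambda>a x. 1 / (a + x)) cs 0"

text \<open>The integer part is always zero, so \<open>stake n \<omega>\<close> lists the first \<open>n\<close> partial quotients
  $a_1, \ldots, a_n$ of the continued fraction given by \<open>\<omega>\<close>.\<close>

definition cfrac :: "real stream \<Rightarrow> real" where
  "cfrac \<omega> = lim (\<lambda>n. finite_cfrac (stake n \<omega>))"

definition cylinder :: "real set \<Rightarrow> real list \<Rightarrow> real set" where
  "cylinder A cs = {cfrac (cs @- \<alpha>) | \<alpha>. \<alpha> \<in> streams A}"

text \<open>The smallest closed interval containing the cylinder, as the intersection of all such
  intervals.  Cylinders are nonempty and bounded when \<open>A\<close> is a nonempty finite set of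
  positive reals and \<open>set cs \<subseteq> A\<close>, so the intersection is then itself a bounded closed
  interval.\<close>

definition cyl_interval :: "real set \<Rightarrow> real list \<Rightarrow> real set" where
  "cyl_interval A cs = \<Inter> {{a..b} | a b. cylinder A cs \<subseteq> {a..b}}"

definition cyl_length :: "real set \<Rightarrow> real list \<Rightarrow> real" where
  "cyl_length A cs = measure lborel (cyl_interval A cs)"

end

theory Submission imports Defs begin

text \<open>
  Let \<open>a < b\<close> be the least and the greatest digit.  For a word \<open>cs\<close> let \<open>T\<close> denote the map
  \<open>x \<mapsto> [0; c\<^sub>1, \<dots>, c\<^sub>m + x]\<close> on the nonnegative reals (\<open>cf_map cs\<close> below).  The values of infinite
  continued fractions range between \<open>p = [0; b, a, b, a, \<dots>]\<close> and \<open>q = [0; a, b, a, b, \<dots>]\<close>, both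
  attained, and these numbers satisfy \<open>p = 1 / (b + q)\<close> and \<open>q = 1 / (a + p)\<close>.  As \<open>T\<close> is
  monotone or antitone, the cylinder interval of \<open>cs\<close> has length \<open>\<bar>T p - T q\<bar>\<close>
  (\<open>cyl_length_eq\<close>).

  The map \<open>T\<close> is a Moebius transformation of determinant \<open>\<plusminus>1\<close>, hence
  \<open>\<bar>T u - T v\<bar> = \<bar>u - v\<bar> / (K (1 + u r) (1 + v r))\<close> with constants \<open>K > 0\<close> and \<open>r \<ge> 0\<close> depending on
  \<open>cs\<close> only (\<open>cf_map_diff\<close>).  Comparing the lengths for \<open>cs\<close> and \<open>cs @ [c]\<close>, the factor \<open>K\<close>
  cancels, and their ratio is
  \<open>(1 + p r) (1 + q r) / ((c + p + r) (c + q + r))\<close>.  Since \<open>1 + p r = p (b + q + r)\<close> and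
  \<open>1 + q r = q (a + p + r)\<close>, this lies between \<open>p / (b + p) > 0\<close> and \<open>q / (a + q) < 1\<close> for every
  \<open>r \<ge> 0\<close> and \<open>a \<le> c \<le> b\<close> (\<open>cyl_ratio_bounds\<close>).

  Convergence of the continued fractions is needed as well, because the digits need not be
  integers.  It follows from the fact that two consecutive digits \<open>\<ge> a\<close> contract distances by a
  factor of at least \<open>1 + a\<^sup>2\<close> (\<open>cf_map_contraction\<close>).
\<close>

section \<open>Finite continued fractions with a variable tail\<close>

text \<open>The continued fraction \<open>[0; c\<^sub>1, \<dots>, c\<^sub>m + x]\<close> as a function of \<open>x\<close>; the identity for the
  empty word.\<close>

definition cf_map :: "real list \<Rightarrow> real \<Rightarrow> real" where
  "cf_map cs x = foldr (\<lambda>a x. 1 / (a + x)) cs x"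

lemma cf_map_Nil [simp]: "cf_map [] x = x"
  by (simp add: cf_map_def)

lemma cf_map_Cons [simp]: "cf_map (c # cs) x = 1 / (c + cf_map cs x)"
  by (simp add: cf_map_def)

lemma cf_map_append: "cf_map (cs @ ds) x = cf_map cs (cf_map ds x)"
  by (simp add: cf_map_def)

lemma finite_cfrac_eq_cf_map: "finite_cfrac cs = cf_map cs 0"
  by (simp add: finite_cfrac_def cf_map_def)

lemma cf_map_nonneg:
  assumes "0 < a" "set cs \<subseteq> {a..}" "0 \<le> x"
  shows "0 \<le> cf_map cs x"
  using assms(2) by (induction cs) (use assms in auto)

lemma cf_map_le:
  assumes "0 < a" "set cs \<subseteq> {a..}" "0 \<le> x" "cs \<noteq> []"
  shows "cf_map cs x \<le> 1 / a"
proof (cases cs)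
  case (Cons c ds)
  have "0 \<le> cf_map ds x" using assms Cons by (intro cf_map_nonneg) auto
  then show ?thesis using assms Cons by (auto intro!: divide_left_mono mult_pos_pos)
qed (use assms in simp)

lemma cf_map_two_digits_contraction:
  fixes a c d x y :: real
  assumes "0 < a" "a \<le> c" "a \<le> d" "0 \<le> x" "0 \<le> y"
  shows "\<bar>1 / (c + 1 / (d + x)) - 1 / (c + 1 / (d + y))\<bar> \<le> \<bar>x - y\<bar> / (1 + a\<^sup>2)"
proof -
  have cd: "0 < c" "0 < d" "0 < d + x" "0 < d + y" using assms by linarith+
  define X Y where "X = c * (d + x) + 1" and "Y = c * (d + y) + 1"
  have XY: "1 + a\<^sup>2 \<le> X" "1 \<le> Y"
    using mult_mono[of a c a "d + x"] cd assms
    by (auto simp: X_def Y_def power2_eq_square)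
  have XY0: "0 < X" "0 < Y" using XY zero_le_power2[of a] by linarith+
  have "1 / (c + 1 / (d + x)) = (d + x) / X" "1 / (c + 1 / (d + y)) = (d + y) / Y"
    using cd by (simp_all add: X_def Y_def field_simps)
  moreover have "(d + x) / X - (d + y) / Y = ((d + x) * Y - (d + y) * X) / (X * Y)"
    using XY0 by (subst diff_frac_eq) auto
  moreover have "(d + x) * Y - (d + y) * X = x - y"
    by (simp add: X_def Y_def algebra_simps)
  ultimately have "\<bar>1 / (c + 1 / (d + x)) - 1 / (c + 1 / (d + y))\<bar> = \<bar>x - y\<bar> / (X * Y)"
    using XY0 by simp
  also have "\<dots> \<le> \<bar>x - y\<bar> / (1 + a\<^sup>2)"
  proof (rule divide_left_mono)
    show "1 + a\<^sup>2 \<le> X * Y" using mult_mono[of "1 + a\<^sup>2" X 1 Y] XY XY0 by simp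
    show "0 < X * Y * (1 + a\<^sup>2)" using XY0 by (simp add: add_pos_nonneg)
  qed simp
  finally show ?thesis .
qed

text \<open>Each of the \<open>k\<close> pairs of leading digits contracts; the one remaining digit bounds the values
  by \<open>1 / a\<close>.\<close>

lemma cf_map_contraction:
  assumes "0 < a" "set cs \<subseteq> {a..}" "2 * k + 1 \<le> length cs" "0 \<le> u" "0 \<le> v"
  shows "\<bar>cf_map cs u - cf_map cs v\<bar> \<le> (1 / (1 + a\<^sup>2)) ^ k / a"
  using assms(2,3)
proof (induction k arbitrary: cs)
  case 0
  then have "cs \<noteq> []" by auto
  then show ?case
    using cf_map_le[OF assms(1) 0(1) assms(4)] cf_map_le[OF assms(1) 0(1) assms(5)]
      cf_map_nonneg[OF assms(1) 0(1) assms(4)] cf_map_nonneg[OF assms(1) 0(1) assms(5)]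
    by simp
next
  case (Suc k)
  then obtain c d ds where cs: "cs = c # d # ds"
    by (cases cs; cases "tl cs") auto
  have ds: "set ds \<subseteq> {a..}" "2 * k + 1 \<le> length ds" "a \<le> c" "a \<le> d"
    using Suc.prems cs by auto
  have "\<bar>cf_map cs u - cf_map cs v\<bar> \<le> \<bar>cf_map ds u - cf_map ds v\<bar> / (1 + a\<^sup>2)"
    unfolding cs cf_map_Cons
    by (intro cf_map_two_digits_contraction cf_map_nonneg[of a] assms ds)
  also have "\<dots> \<le> ((1 / (1 + a\<^sup>2)) ^ k / a) / (1 + a\<^sup>2)"
    by (intro divide_right_mono Suc.IH ds) auto
  finally show ?case by (simp add: mult.commute)
qed

text \<open>If \<open>P' / Q'\<close> and \<open>P / Q\<close> are the last two convergents, then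
  \<open>cf_map cs x = (P + x P') / (Q + x Q')\<close>.  The constants below are \<open>K = Q\<^sup>2\<close> and \<open>r = Q' / Q\<close>;
  appending a digit \<open>c\<close> replaces \<open>Q'\<close> by \<open>Q\<close> and \<open>Q\<close> by \<open>c Q + Q'\<close>, that is, \<open>r\<close> by
  \<open>1 / (c + r)\<close>.\<close>

lemma cf_map_diff:
  assumes "0 < a" "set cs \<subseteq> {a..}"
  obtains K r where "0 < K" "0 \<le> r"
    "\<And>u v. 0 \<le> u \<Longrightarrow> 0 \<le> v \<Longrightarrow>
      \<bar>cf_map cs u - cf_map cs v\<bar> = \<bar>u - v\<bar> / (K * (1 + u * r) * (1 + v * r))"
proof -
  have "\<exists>K r. 0 < K \<and> 0 \<le> r \<and> (\<forall>u v. 0 \<le> u \<longrightarrow> 0 \<le> v \<longrightarrow>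
      \<bar>cf_map cs u - cf_map cs v\<bar> = \<bar>u - v\<bar> / (K * (1 + u * r) * (1 + v * r)))"
    using assms(2)
  proof (induction cs rule: rev_induct)
    case Nil
    show ?case by (rule exI[of _ 1], rule exI[of _ 0]) simp
  next
    case (snoc c cs)
    then obtain K r where K: "0 < K" "0 \<le> r" and
      eq: "\<And>u v. 0 \<le> u \<Longrightarrow> 0 \<le> v \<Longrightarrow>
        \<bar>cf_map cs u - cf_map cs v\<bar> = \<bar>u - v\<bar> / (K * (1 + u * r) * (1 + v * r))"
      by auto
    have c: "0 < c" using snoc assms by auto
    show ?case
    proof (intro exI conjI allI impI)
      show "0 < K * (c + r)\<^sup>2" "0 \<le> 1 / (c + r)" using K c by auto
      fix u v :: real assume uv: "0 \<le> u" "0 \<le> v"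
      have pos: "0 < c + u" "0 < c + v" "0 < c + r" "0 < c + u + r" "0 < c + v + r"
        using uv c K by linarith+
      have "1 / (c + u) - 1 / (c + v) = (v - u) / ((c + u) * (c + v))"
        using pos by (simp add: field_simps)
      then have d: "\<bar>1 / (c + u) - 1 / (c + v)\<bar> = \<bar>u - v\<bar> / ((c + u) * (c + v))"
        using pos by (simp add: abs_mult)
      have f: "1 + 1 / (c + u) * r = (c + u + r) / (c + u)"
        "1 + 1 / (c + v) * r = (c + v + r) / (c + v)"
        "1 + u * (1 / (c + r)) = (c + u + r) / (c + r)"
        "1 + v * (1 / (c + r)) = (c + v + r) / (c + r)"
        using pos by (simp_all add: field_simps)
      have "\<bar>cf_map (cs @ [c]) u - cf_map (cs @ [c]) v\<bar>
          = \<bar>1 / (c + u) - 1 / (c + v)\<bar> / (K * (1 + 1 / (c + u) * r) * (1 + 1 / (c + v) * r))"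
        using pos eq[of "1 / (c + u)" "1 / (c + v)"] by (simp add: cf_map_append)
      also have "\<dots> = \<bar>u - v\<bar> / (K * (c + u + r) * (c + v + r))"
        unfolding d f using pos by simp
      also have "\<dots> = \<bar>u - v\<bar> / (K * (c + r)\<^sup>2 * (1 + u * (1 / (c + r))) * (1 + v * (1 / (c + r))))"
        unfolding f using pos by (simp add: power2_eq_square)
      finally show "\<bar>cf_map (cs @ [c]) u - cf_map (cs @ [c]) v\<bar>
          = \<bar>u - v\<bar> / (K * (c + r)\<^sup>2 * (1 + u * (1 / (c + r))) * (1 + v * (1 / (c + r))))" .
    qed
  qed
  then show thesis using that by blast
qed

text \<open>Whether \<open>cf_map cs\<close> increases or decreases depends on the parity of the length of \<open>cs\<close>; for
  cylinder intervals only the preservation of betweenness matters.\<close>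

lemma cf_map_between:
  assumes "0 < a" "set cs \<subseteq> {a..}" "0 \<le> u" "u \<le> x" "x \<le> v"
  shows "cf_map cs x \<in> {min (cf_map cs u) (cf_map cs v)..max (cf_map cs u) (cf_map cs v)}"
  using assms(2)
proof (induction cs)
  case (Cons c cs)
  have nn: "0 \<le> cf_map cs u" "0 \<le> cf_map cs x" "0 \<le> cf_map cs v"
    using Cons.prems assms by (auto intro!: cf_map_nonneg[of a])
  have c: "0 < c" using Cons.prems assms by auto
  have anti: "1 / (c + z) \<le> 1 / (c + y)" if "0 \<le> y" "y \<le> z" for y z
    using that c by (intro divide_left_mono mult_pos_pos) auto
  have "cf_map cs u \<le> cf_map cs x \<and> cf_map cs x \<le> cf_map cs v \<or>
      cf_map cs v \<le> cf_map cs x \<and> cf_map cs x \<le> cf_map cs u"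
    using Cons by (auto simp: min_def max_def split: if_splits)
  then show ?case
    using anti nn by (auto simp: min_le_iff_disj le_max_iff_disj)
qed (use assms in auto)

section \<open>Infinite continued fractions\<close>

lemma set_stake_streams: "\<omega> \<in> streams A \<Longrightarrow> set (stake n \<omega>) \<subseteq> A"
  by (auto simp: in_set_conv_nth snth_in)

lemma sdrop_in_streams: "\<omega> \<in> streams A \<Longrightarrow> sdrop n \<omega> \<in> streams A"
  by (simp add: streams_iff_snth sdrop_snth)

lemma cfrac_convergent:
  assumes "0 < a" "\<omega> \<in> streams {a..}"
  shows "convergent (\<lambda>n. finite_cfrac (stake n \<omega>))"
proof -
  define q where "q = 1 / (1 + a\<^sup>2)"
  have q: "\<bar>q\<bar> < 1" using assms by (simp add: q_def add_pos_nonneg)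
  have est: "\<bar>finite_cfrac (stake m \<omega>) - finite_cfrac (stake (2 * k + 1) \<omega>)\<bar> \<le> q ^ k / a"
    if "2 * k + 1 \<le> m" for k m
  proof -
    have "stake m \<omega> = stake (2 * k + 1) \<omega> @ stake (m - (2 * k + 1)) (sdrop (2 * k + 1) \<omega>)"
      using that by (metis le_add_diff_inverse stake_add)
    then have "finite_cfrac (stake m \<omega>) = cf_map (stake (2 * k + 1) \<omega>)
        (cf_map (stake (m - (2 * k + 1)) (sdrop (2 * k + 1) \<omega>)) 0)"
      by (simp only: finite_cfrac_eq_cf_map cf_map_append)
    then show ?thesis
      unfolding q_def finite_cfrac_eq_cf_map using assms
      by (simp only:)
        (intro cf_map_contraction cf_map_nonneg[of a] set_stake_streams sdrop_in_streams; simp)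
  qed
  have "Cauchy (\<lambda>n. finite_cfrac (stake n \<omega>))"
  proof (rule CauchyI')
    fix \<epsilon> :: real assume "0 < \<epsilon>"
    have "(\<lambda>k. q ^ k / a) \<longlonglongrightarrow> 0"
      using tendsto_divide[OF LIMSEQ_abs_realpow_zero2[OF q] tendsto_const, of a] assms by simp
    then have "eventually (\<lambda>k. q ^ k / a < \<epsilon> / 2) sequentially"
      using \<open>0 < \<epsilon>\<close> by (intro order_tendstoD) auto
    then obtain k where k: "q ^ k / a < \<epsilon> / 2"
      by (auto simp: eventually_sequentially)
    show "\<exists>M. \<forall>m\<ge>M. \<forall>n>m. dist (finite_cfrac (stake m \<omega>)) (finite_cfrac (stake n \<omega>)) < \<epsilon>"
    proof (intro exI[of _ "2 * k + 1"] allI impI)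
      fix m n assume "2 * k + 1 \<le> m" "m < n"
      then show "dist (finite_cfrac (stake m \<omega>)) (finite_cfrac (stake n \<omega>)) < \<epsilon>"
        using est[of k m] est[of k n] k unfolding dist_real_def by linarith
    qed
  qed
  then show ?thesis by (simp add: Cauchy_convergent_iff)
qed

lemma cfrac_tendsto:
  assumes "0 < a" "\<omega> \<in> streams {a..}"
  shows "(\<lambda>n. cf_map (stake n \<omega>) 0) \<longlonglongrightarrow> cfrac \<omega>"
  using cfrac_convergent[OF assms]
  unfolding cfrac_def finite_cfrac_eq_cf_map convergent_LIMSEQ_iff .

lemma cfrac_nonneg:
  assumes "0 < a" "\<omega> \<in> streams {a..}"
  shows "0 \<le> cfrac \<omega>"
proof (rule LIMSEQ_le_const[OF cfrac_tendsto[OF assms]], intro exI allI impI)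
  show "0 \<le> cf_map (stake n \<omega>) 0" for n
    by (rule cf_map_nonneg[OF assms(1) set_stake_streams[OF assms(2)] order_refl])
qed

lemma cfrac_SCons:
  assumes "0 < a" "\<omega> \<in> streams {a..}" "a \<le> c"
  shows "cfrac (c ## \<omega>) = 1 / (c + cfrac \<omega>)"
proof (rule LIMSEQ_unique)
  have "c ## \<omega> \<in> streams {a..}" using assms by (intro streams.intros) auto
  then show "(\<lambda>n. cf_map (stake (Suc n) (c ## \<omega>)) 0) \<longlonglongrightarrow> cfrac (c ## \<omega>)"
    by (intro LIMSEQ_Suc cfrac_tendsto[OF assms(1)])
  have "c + cfrac \<omega> \<noteq> 0" using cfrac_nonneg[OF assms(1,2)] assms by linarith
  then show "(\<lambda>n. cf_map (stake (Suc n) (c ## \<omega>)) 0) \<longlonglongrightarrow> 1 / (c + cfrac \<omega>)"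
    by (auto intro!: tendsto_intros cfrac_tendsto[OF assms(1,2)])
qed

lemma cfrac_shift:
  assumes "0 < a" "\<omega> \<in> streams {a..}" "set cs \<subseteq> {a..}"
  shows "cfrac (cs @- \<omega>) = cf_map cs (cfrac \<omega>)"
  using assms(3)
proof (induction cs)
  case (Cons c cs)
  then have "cs @- \<omega> \<in> streams {a..}" using assms by (auto intro!: shift_streams)
  then show ?case using Cons cfrac_SCons[OF assms(1)] by simp
qed simp

text \<open>The limit does not depend on the tail that is put in place of the remaining digits.\<close>

lemma cf_map_stake_tendsto:
  assumes "0 < a" "\<omega> \<in> streams {a..}" "0 \<le> x"
  shows "(\<lambda>n. cf_map (stake (2 * n + 1) \<omega>) x) \<longlonglongrightarrow> cfrac \<omega>"
proof (rule Lim_transform)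
  have "strict_mono (\<lambda>n. 2 * n + 1 :: nat)" by (auto simp: strict_mono_def)
  from LIMSEQ_subseq_LIMSEQ[OF cfrac_tendsto[OF assms(1,2)] this]
  show "(\<lambda>n. cf_map (stake (2 * n + 1) \<omega>) 0) \<longlonglongrightarrow> cfrac \<omega>" by (simp only: o_def)
  have q: "\<bar>1 / (1 + a\<^sup>2)\<bar> < 1" using assms by (simp add: add_pos_nonneg)
  have lim: "(\<lambda>k. (1 / (1 + a\<^sup>2)) ^ k / a) \<longlonglongrightarrow> 0"
    using tendsto_divide[OF LIMSEQ_abs_realpow_zero2[OF q] tendsto_const, of a] assms by simp
  have "norm (cf_map (stake (2 * n + 1) \<omega>) x - cf_map (stake (2 * n + 1) \<omega>) 0)
      \<le> (1 / (1 + a\<^sup>2)) ^ n / a" for n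
    unfolding real_norm_def using assms
    by (intro cf_map_contraction set_stake_streams) auto
  then show "(\<lambda>n. cf_map (stake (2 * n + 1) \<omega>) x - cf_map (stake (2 * n + 1) \<omega>) 0) \<longlonglongrightarrow> 0"
    by (intro tendsto_0_le[OF lim, of _ 1] always_eventually allI) (smt (verit) real_norm_def)
qed

section \<open>Extreme values and lengths of cylinder intervals\<close>

lemma cycle_two_in_streams: "x \<in> A \<Longrightarrow> y \<in> A \<Longrightarrow> cycle [x, y] \<in> streams A"
  by (simp add: streams_iff_sset)

lemma cfrac_cycle_two:
  assumes "0 < a" "a \<le> x" "a \<le> y"
  shows "cfrac (cycle [x, y]) = 1 / (x + cfrac (cycle [y, x]))"
proof -
  have "cycle [x, y] = x ## cycle [y, x]" using cycle_Cons[of x "[y]"] by simp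
  then show ?thesis
    using cfrac_SCons[OF assms(1) cycle_two_in_streams] assms by simp
qed

text \<open>Each map \<open>x \<mapsto> 1 / (c + x)\<close> with \<open>a \<le> c \<le> b\<close> sends the interval between the two extreme
  values into itself.\<close>

lemma cfrac_bounds:
  assumes "0 < a" "a \<le> b" "\<omega> \<in> streams {a..b}"
  shows "cfrac \<omega> \<in> {cfrac (cycle [b, a])..cfrac (cycle [a, b])}"
proof -
  define p q where "p = cfrac (cycle [b, a])" and "q = cfrac (cycle [a, b])"
  have pq: "p = 1 / (b + q)" "q = 1 / (a + p)"
    unfolding p_def q_def using assms by (auto intro!: cfrac_cycle_two[of a])
  have nn: "0 \<le> p" "0 \<le> q"
    unfolding p_def q_def using assms
    by (auto intro!: cfrac_nonneg[of a] cycle_two_in_streams)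
  have "p \<le> q"
  proof (rule ccontr)
    assume "\<not> p \<le> q"
    have "p * (b + q) = 1" "q * (a + p) = 1"
      using nonzero_eq_divide_eq[of "b + q" p 1] nonzero_eq_divide_eq[of "a + p" q 1] pq nn assms
      by linarith+
    then have "p * b = q * a" by (simp add: algebra_simps)
    moreover have "q * a < p * a" using \<open>\<not> p \<le> q\<close> assms by simp
    moreover have "p * a \<le> p * b" using nn assms by (intro mult_left_mono)
    ultimately show False by linarith
  qed
  have inv: "cf_map cs p \<in> {p..q}" if "set cs \<subseteq> {a..b}" for cs
    using that
  proof (induction cs)
    case (Cons c cs)
    then have "1 / (b + q) \<le> 1 / (c + cf_map cs p)" "1 / (c + cf_map cs p) \<le> 1 / (a + p)"
      using nn assms by (intro frac_le; auto)+
    then show ?case by (simp flip: pq)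
  qed (use \<open>p \<le> q\<close> in simp)
  have "\<omega> \<in> streams {a..}" by (rule streams_mono[OF assms(3)]) simp
  then have lim: "(\<lambda>n. cf_map (stake (2 * n + 1) \<omega>) p) \<longlonglongrightarrow> cfrac \<omega>"
    by (rule cf_map_stake_tendsto[OF assms(1) _ nn(1)])
  have "cfrac \<omega> \<in> {p..q}"
    by (rule Lim_in_closed_set[OF closed_atLeastAtMost _ sequentially_bot lim])
      (intro always_eventually allI inv set_stake_streams[OF assms(3)])
  then show ?thesis by (simp add: p_def q_def)
qed

lemma cyl_length_eq:
  assumes "0 < a" "a \<in> A" "b \<in> A" "A \<subseteq> {a..b}" "set cs \<subseteq> A"
  defines "p \<equiv> cfrac (cycle [b, a])" and "q \<equiv> cfrac (cycle [a, b])"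
  shows "cyl_length A cs = \<bar>cf_map cs p - cf_map cs q\<bar>"
proof -
  have sub: "streams A \<subseteq> streams {a..}" "set cs \<subseteq> {a..}"
    using assms by (auto intro!: streams_mono2)
  have ab: "a \<le> b" using assms by auto
  have cyc: "cycle [b, a] \<in> streams A" "cycle [a, b] \<in> streams A"
    using assms by (auto intro!: cycle_two_in_streams)
  have p: "0 \<le> p" unfolding p_def using assms(1) cyc sub by (intro cfrac_nonneg[of a]) auto
  let ?l = "min (cf_map cs p) (cf_map cs q)" and ?u = "max (cf_map cs p) (cf_map cs q)"
  have cyl: "cylinder A cs = {cf_map cs (cfrac \<omega>) |\<omega>. \<omega> \<in> streams A}"
    unfolding cylinder_def setcompr_eq_image
    using sub by (auto intro!: image_cong cfrac_shift[OF assms(1)])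
  have "cylinder A cs \<subseteq> {?l..?u}"
  proof
    fix y assume "y \<in> cylinder A cs"
    then obtain \<omega> where y: "y = cf_map cs (cfrac \<omega>)" and \<omega>: "\<omega> \<in> streams A"
      using cyl by blast
    have "cfrac \<omega> \<in> {p..q}"
      unfolding p_def q_def using \<omega> streams_mono2[OF assms(4)] assms(1) ab
      by (intro cfrac_bounds) auto
    then show "y \<in> {?l..?u}"
      unfolding y using p by (intro cf_map_between[OF assms(1) sub(2)]) auto
  qed
  \<comment> \<open>The end points themselves belong to the cylinder.\<close>
  moreover have "{?l..?u} \<subseteq> {x..y}" if "cylinder A cs \<subseteq> {x..y}" for x y
  proof -
    have "cf_map cs p \<in> cylinder A cs" "cf_map cs q \<in> cylinder A cs"
      using cyl cyc unfolding p_def q_def by blast+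
    then show ?thesis using that by auto
  qed
  ultimately have "cyl_interval A cs = {?l..?u}"
    unfolding cyl_interval_def by blast
  then show ?thesis by (simp add: cyl_length_def min_def max_def)
qed

section \<open>The ratio of lengths\<close>

text \<open>The bounds depend neither on \<open>c\<close> nor on \<open>r\<close>: the quotient
  \<open>(b + q + r) / (c + q + r)\<close> is at least 1 and is largest for \<open>c = a\<close>, \<open>r = 0\<close>, while
  \<open>(a + p + r) / (c + p + r)\<close> is at most 1 and is smallest for \<open>c = b\<close>, \<open>r = 0\<close>.\<close>

lemma cyl_ratio_bounds:
  assumes "0 < a" "a < b" "a \<in> A" "b \<in> A" "A \<subseteq> {a..b}" "set cs \<subseteq> A" "c \<in> A"
  defines "p \<equiv> cfrac (cycle [b, a])" and "q \<equiv> cfrac (cycle [a, b])"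
  shows "p / (b + p) \<le> cyl_length A (cs @ [c]) / cyl_length A cs"
    and "cyl_length A (cs @ [c]) / cyl_length A cs \<le> q / (a + q)"
    and "0 < p" and "0 < q"
proof -
  have pq: "p = 1 / (b + q)" "q = 1 / (a + p)"
    unfolding p_def q_def using assms by (auto intro!: cfrac_cycle_two[of a])
  have nn: "0 \<le> p" "0 \<le> q"
    unfolding p_def q_def using assms
    by (auto intro!: cfrac_nonneg[of a] cycle_two_in_streams)
  show p: "0 < p" and q: "0 < q" using nn assms(1,2) by (subst pq; simp)+
  have pq1: "p * (b + q) = 1" "q * (a + p) = 1"
    using nonzero_eq_divide_eq[of "b + q" p 1] nonzero_eq_divide_eq[of "a + p" q 1] pq nn assms(1,2)
    by linarith+
  have "p \<noteq> q"
  proof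
    assume "p = q"
    then have "q * (b + q) = q * (a + q)" using pq1 by simp
    then show False using q assms(2) by simp
  qed
  have c: "a \<le> c" "c \<le> b" using assms by auto
  have "set cs \<subseteq> {a..}" using assms by auto
  from cf_map_diff[OF assms(1) this] obtain K r where K: "0 < K" "0 \<le> r" and
    eq: "\<And>u v. 0 \<le> u \<Longrightarrow> 0 \<le> v \<Longrightarrow>
      \<bar>cf_map cs u - cf_map cs v\<bar> = \<bar>u - v\<bar> / (K * (1 + u * r) * (1 + v * r))"
    by blast
  have pos: "0 < c + p" "0 < c + q" "0 < c + p + r" "0 < c + q + r"
    "0 < 1 + p * r" "0 < 1 + q * r"
    using c p q K assms(1) by (auto intro!: add_pos_nonneg)
  have len: "cyl_length A cs = \<bar>p - q\<bar> / (K * (1 + p * r) * (1 + q * r))"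
    using cyl_length_eq[of a A b cs] eq[of p q] nn assms unfolding p_def q_def by auto
  have "cyl_length A (cs @ [c]) = \<bar>cf_map cs (1 / (c + p)) - cf_map cs (1 / (c + q))\<bar>"
    using cyl_length_eq[of a A b "cs @ [c]"] assms by (simp add: cf_map_append p_def q_def)
  also have "\<dots> = \<bar>1 / (c + p) - 1 / (c + q)\<bar> / (K * (1 + 1 / (c + p) * r) * (1 + 1 / (c + q) * r))"
    using pos by (intro eq) auto
  also have "1 / (c + p) - 1 / (c + q) = (q - p) / ((c + p) * (c + q))"
    using pos by (simp add: field_simps)
  also have "1 + 1 / (c + p) * r = (c + p + r) / (c + p)"
    using pos by (simp add: field_simps)
  also have "1 + 1 / (c + q) * r = (c + q + r) / (c + q)"
    using pos by (simp add: field_simps)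
  also have "\<bar>(q - p) / ((c + p) * (c + q))\<bar> = \<bar>p - q\<bar> / ((c + p) * (c + q))"
    using pos by (simp add: abs_mult)
  also have "\<bar>p - q\<bar> / ((c + p) * (c + q)) /
      (K * ((c + p + r) / (c + p)) * ((c + q + r) / (c + q)))
      = \<bar>p - q\<bar> / (K * (c + p + r) * (c + q + r))"
    using pos by simp
  finally have len': "cyl_length A (cs @ [c]) = \<bar>p - q\<bar> / (K * (c + p + r) * (c + q + r))" .
  have "cyl_length A (cs @ [c]) / cyl_length A cs
      = ((1 + p * r) * (1 + q * r)) / ((c + p + r) * (c + q + r))"
    unfolding len len' using pos K \<open>p \<noteq> q\<close> by simp
  also have "(1 + p * r) = p * (b + q + r)"
    using pq1 by (simp add: algebra_simps)
  also have "(1 + q * r) = q * (a + p + r)"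
    using pq1 by (simp add: algebra_simps)
  also have "p * (b + q + r) * (q * (a + p + r)) / ((c + p + r) * (c + q + r))
      = p * q * ((b + q + r) / (c + q + r)) * ((a + p + r) / (c + p + r))"
    by (simp add: mult_ac)
  finally have ratio: "cyl_length A (cs @ [c]) / cyl_length A cs
      = p * q * ((b + q + r) / (c + q + r)) * ((a + p + r) / (c + p + r))" .
  have "p / (b + p) = p * q * 1 * ((a + p) / (b + p))"
    using pq1(2) by (simp add: mult.assoc)
  also have "\<dots> \<le> p * q * ((b + q + r) / (c + q + r)) * ((a + p + r) / (c + p + r))"
  proof (intro mult_mono order_refl)
    show "1 \<le> (b + q + r) / (c + q + r)" using pos c by simp
    have "(a + p) / (b + p) \<le> (a + p + r) / (b + p + r)"
      using assms(1,2) p K by (simp add: divide_simps) (simp add: algebra_simps mult_right_mono)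
    also have "\<dots> \<le> (a + p + r) / (c + p + r)"
      using assms(1) p K c by (intro divide_left_mono) auto
    finally show "(a + p) / (b + p) \<le> (a + p + r) / (c + p + r)" .
  qed (use p q K assms(1,2) c in auto)
  finally show "p / (b + p) \<le> cyl_length A (cs @ [c]) / cyl_length A cs"
    unfolding ratio .
  have "p * q * ((b + q + r) / (c + q + r)) * ((a + p + r) / (c + p + r))
      \<le> p * q * ((b + q) / (a + q)) * 1"
  proof (intro mult_mono order_refl)
    have "(b + q + r) / (c + q + r) \<le> (b + q + r) / (a + q + r)"
      using assms(1,2) q K c by (intro divide_left_mono) auto
    also have "\<dots> \<le> (b + q) / (a + q)"
      using assms(1,2) q K by (simp add: divide_simps) (simp add: algebra_simps mult_right_mono)
    finally show "(b + q + r) / (c + q + r) \<le> (b + q) / (a + q)" .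
    show "(a + p + r) / (c + p + r) \<le> 1" using pos c by simp
  qed (use p q K assms(1,2) c in auto)
  also have "\<dots> = q / (a + q)"
  proof -
    have "p * q * ((b + q) / (a + q)) * 1 = (p * (b + q)) * q / (a + q)" by simp
    then show ?thesis using pq1(1) by simp
  qed
  finally show "cyl_length A (cs @ [c]) / cyl_length A cs \<le> q / (a + q)"
    unfolding ratio .
qed

theorem theorem12:
  fixes s :: nat and e :: "nat \<Rightarrow> real" and A :: "real set"
  assumes "s \<ge> 2"
    and "0 < e 0"
    and "strict_mono_on {..<s} e"
    and "A = e ` {..<s}"
  shows "\<exists>C1 C2. 0 < C1 \<and> C2 < 1 \<and>
    (\<forall>m\<ge>1. \<forall>cs. length cs = m \<and> set cs \<subseteq> A \<longrightarrow>
      (\<forall>c\<in>A. C1 < cyl_length A (cs @ [c]) / cyl_length A cs \<and>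
             cyl_length A (cs @ [c]) / cyl_length A cs < C2))"
proof -
  define a b where "a = e 0" and "b = e (s - 1)"
  have ab: "0 < a" "a < b" "a \<in> A" "b \<in> A"
    using assms strict_mono_onD[OF assms(3), of 0 "s - 1"] by (auto simp: a_def b_def)
  have A: "A \<subseteq> {a..b}"
    using strict_mono_on_leD[OF assms(3)] assms by (auto simp: a_def b_def)
  define p q where "p = cfrac (cycle [b, a])" and "q = cfrac (cycle [a, b])"
  note bounds = cyl_ratio_bounds[OF ab A, folded p_def q_def]
  have pq: "0 < p" "0 < q" using bounds(3,4)[of "[]" a] ab by auto
  define D1 D2 where "D1 = p / (b + p)" and "D2 = q / (a + q)"
  have D: "0 < D1" "D2 < 1" using pq ab by (auto simp: D1_def D2_def)
  \<comment> \<open>Halving \<open>D1\<close> and moving \<open>D2\<close> towards 1 makes the inequalities strict.\<close>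
  show ?thesis
  proof (rule exI[of _ "D1 / 2"], rule exI[of _ "(1 + D2) / 2"], intro conjI allI ballI impI)
    show "0 < D1 / 2" "(1 + D2) / 2 < 1" using D by auto
    fix m :: nat and cs c assume "length cs = m \<and> set cs \<subseteq> A" "c \<in> A"
    then have *: "D1 \<le> cyl_length A (cs @ [c]) / cyl_length A cs"
      "cyl_length A (cs @ [c]) / cyl_length A cs \<le> D2"
      using bounds(1,2)[of cs c] by (simp_all add: D1_def D2_def)
    show "D1 / 2 < cyl_length A (cs @ [c]) / cyl_length A cs"
      using D(1) by (intro less_le_trans[OF _ *(1)]) simp
    show "cyl_length A (cs @ [c]) / cyl_length A cs < (1 + D2) / 2"
      using D(2) by (intro le_less_trans[OF *(2)]) simp
  qed
qed

end
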